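(* Let $0\le\mu<L$ and let $f:\mathbb{R}^d\to\mathbb{R}$ be a differentiable function. Then $f$ is $L$-smooth and $\mu$-strongly-convex if and only if any one of the following two conditions holds (that is, each of the two conditions is individually equivalent to $f$ being both $L$-smooth and $\mu$-strongly-convex): (a) for all $x,y\in\mathbb{R}^d$, $$\langle\nabla f(x)-\nabla f(y),x-y\rangle\ \ge\ \frac{L\mu}{L+\mu}\|x-y\|^2+\frac{1}{L+\mu}\|\nabla f(x)-\nabla f(y)\|^2;$$ (b) for all $x,y\in\mathbb{R}^d$, $$f(y)\ \ge\ f(x)+\langle\nabla f(x),y-x\rangle+\frac{1}{2L}\|\nabla f(x)-\nabla f(y)\|^2+\frac{\mu L}{2(L-\mu)}\Bigl\|x-y-\frac1L\bigl(\nabla f(x)-\nabla f(y)\bigr)\Bigr\|^2.$$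
   Context: $\mathbb{R}^d$ carries the dot product $\langle\cdot,\cdot\rangle$ and the induced Euclidean norm $\|\cdot\|$. For a differentiable function $h$, the Bregman distance is $D_h(x,y):=h(x)-h(y)-\langle\nabla h(y),x-y\rangle$. Let $\varphi_0=\frac12\|\cdot\|^2$. A differentiable function $f:\mathbb{R}^d\to\mathbb{R}$ is called $L$-smooth if $D_f(x,y)\le L\,D_{\varphi_0}(x,y)$ for all $x,y\in\mathbb{R}^d$, and $\mu$-strongly-convex if $\mu\,D_{\varphi_0}(x,y)\le D_f(x,y)$ for all $x,y\in\mathbb{R}^d$. *)

theory Defs
  imports "HOL-Analysis.Analysis"
begin

definition grad :: "('a::euclidean_space \<Rightarrow> real) \<Rightarrow> 'a \<Rightarrow> 'a"
  where "grad h x = (THE D. GDERIV h x :> D)"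

lemma grad_eqI:
  fixes h :: "'a::euclidean_space \<Rightarrow> real"
  assumes "GDERIV h x :> D"
  shows "grad h x = D"
  unfolding grad_def
proof (rule the_equality)
  fix E assume "GDERIV h x :> E"
  then have "(\<lambda>k. inner k E) = (\<lambda>k. inner k D)"
    using assms unfolding gderiv_def by (rule has_derivative_unique)
  then show "E = D"
    by (metis vector_eq_ldot)
qed (rule assms)

lemma GDERIV_grad:
  fixes h :: "'a::euclidean_space \<Rightarrow> real"
  assumes "h differentiable at x"
  shows "GDERIV h x :> grad h x"
proof -
  obtain h' where h': "(h has_derivative h') (at x)"
    using assms by (auto simp: differentiable_def)
  then have lin: "linear h'"
    by (rule has_derivative_linear)
  have "h' k = inner k (adjoint h' 1)" for k
    using adjoint_works[OF lin, of k 1] by simp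
  then have "h' = (\<lambda>k. inner k (adjoint h' 1))"
    by blast
  then have "GDERIV h x :> adjoint h' 1"
    using h' unfolding gderiv_def by simp
  then show ?thesis
    using grad_eqI by metis
qed

definition Bregman :: "('a::euclidean_space \<Rightarrow> real) \<Rightarrow> 'a \<Rightarrow> 'a \<Rightarrow> real"
  where "Bregman h x y = h x - h y - inner (grad h y) (x - y)"

definition phi0 :: "'a::euclidean_space \<Rightarrow> real"
  where "phi0 x = 1 / 2 * (norm x)\<^sup>2"

(* These two notions are only meaningful for differentiable f; they do not assert it.
   The first bounds only one side of the Bregman distance, so it does not by itself
   make the gradient Lipschitz. *)

definition L_smooth :: "real \<Rightarrow> ('a::euclidean_space \<Rightarrow> real) \<Rightarrow> bool"
  where "L_smooth L f \<longleftrightarrow> (\<forall>x y. Bregman f x y \<le> L * Bregman phi0 x y)"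

definition strongly_convex :: "real \<Rightarrow> ('a::euclidean_space \<Rightarrow> real) \<Rightarrow> bool"
  where "strongly_convex \<mu> f \<longleftrightarrow> (\<forall>x y. \<mu> * Bregman phi0 x y \<le> Bregman f x y)"

end

theory Submission
  imports Defs
begin

text \<open>
  For fixed x and y write \<open>d = x - y\<close> and \<open>G = grad f x - grad f y\<close>. Since the Bregman distance
  of \<open>phi0\<close> is half the squared distance, smoothness and strong convexity together say that
  \<open>g = f - \<mu> phi0\<close> has a Bregman distance between 0 and that of \<open>(L - \<mu>) phi0\<close>.
  The proof is a cycle: smoothness and strong convexity give (b), which gives (a), which gives back
  smoothness and strong convexity.

  The right-hand side of (b) is an expanded form of the cocoercivity bound for \<open>g\<close>
  (\<open>interpolation_remainder_eq\<close>). That bound is obtained by playing convexity at x off against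
  smoothness at y, both evaluated at the point reached from y by a gradient step with
  step size \<open>1 / (L - \<mu>)\<close> (\<open>bregman_ge_of_quadratic_bounds\<close>).
  Adding (b) to itself with x and y exchanged removes the function values and leaves (a).
  Finally, (a) says that \<open>(G - \<mu> d) \<bullet> (L d - G) \<ge> 0\<close> (\<open>cocoercive_iff\<close>). So G lies in the closed
  ball that has the segment from \<open>\<mu> d\<close> to \<open>L d\<close> as a diameter, and therefore
  \<open>\<mu> (d \<bullet> d) \<le> G \<bullet> d \<le> L (d \<bullet> d)\<close>. Integrating these two inequalities along the segment from
  y to x gives the two Bregman bounds (\<open>bregman_ge_of_monotone_gradient\<close>).
\<close>

lemma Bregman_phi0:
  fixes x y :: "'a::euclidean_space"
  shows "Bregman phi0 x y = (norm (x - y))\<^sup>2 / 2"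
proof -
  have "GDERIV phi0 y :> y"
    unfolding gderiv_def phi0_def power2_norm_eq_inner
    by (auto intro!: derivative_eq_intros simp: inner_commute)
  then have "grad phi0 y = y"
    by (rule grad_eqI)
  then show ?thesis
    by (simp add: Bregman_def phi0_def power2_norm_eq_inner inner_diff_left inner_diff_right
        inner_commute field_simps)
qed

lemma L_smooth_iff:
  "L_smooth L f \<longleftrightarrow> (\<forall>x y. f x - f y - grad f y \<bullet> (x - y) \<le> L * ((norm (x - y))\<^sup>2 / 2))"
  by (simp only: L_smooth_def Bregman_phi0 Bregman_def[of f])

lemma strongly_convex_iff:
  "strongly_convex \<mu> f \<longleftrightarrow>
     (\<forall>x y. \<mu> * ((norm (x - y))\<^sup>2 / 2) \<le> f x - f y - grad f y \<bullet> (x - y))"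
  by (simp only: strongly_convex_def Bregman_phi0 Bregman_def[of f])

text \<open>
  The difference of the two sides has, along the segment from y to x, the derivative
  \<open>(p (y + t d) - p y) \<bullet> d - m t (d \<bullet> d)\<close>, which is nonnegative because it is the hypothesis for
  the points \<open>y + t d\<close> and y, divided by t. The sign of m is arbitrary, so that
  the lemma applied to \<open>-h\<close> also yields upper bounds.
\<close>

lemma bregman_ge_of_monotone_gradient:
  fixes h :: "'a::real_inner \<Rightarrow> real" and p :: "'a \<Rightarrow> 'a"
  assumes grad: "\<And>x. GDERIV h x :> p x"
    and mono: "\<And>x y. m * (norm (x - y))\<^sup>2 \<le> (p x - p y) \<bullet> (x - y)"
  shows "m * ((norm (x - y))\<^sup>2 / 2) \<le> h x - h y - p y \<bullet> (x - y)"
proof -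
  define d where "d = x - y"
  define k where "k t = h (y + t *\<^sub>R d) - t * (p y \<bullet> d) - m * t\<^sup>2 / 2 * (d \<bullet> d)" for t
  define k' where "k' t = p (y + t *\<^sub>R d) \<bullet> d - p y \<bullet> d - m * t * (d \<bullet> d)" for t
  have deriv: "(k has_real_derivative k' t) (at t)" for t
  proof -
    have "((\<lambda>t. y + t *\<^sub>R d) has_derivative (\<lambda>s. s *\<^sub>R d)) (at t)"
      by (auto intro!: derivative_eq_intros)
    then have "((\<lambda>t. h (y + t *\<^sub>R d)) has_derivative (\<lambda>s. (s *\<^sub>R d) \<bullet> p (y + t *\<^sub>R d))) (at t)"
      using grad[of "y + t *\<^sub>R d"] unfolding gderiv_def by (rule has_derivative_compose)
    then have "((\<lambda>t. h (y + t *\<^sub>R d)) has_real_derivative p (y + t *\<^sub>R d) \<bullet> d) (at t)"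
      by (simp add: has_field_derivative_def inner_commute mult_commute_abs)
    then show ?thesis
      unfolding k_def k'_def
      by (auto intro!: derivative_eq_intros)
  qed
  have nonneg: "0 \<le> k' t" if "0 \<le> t" for t
  proof (cases "t = 0")
    case False
    have "m * (norm (t *\<^sub>R d))\<^sup>2 \<le> (p (y + t *\<^sub>R d) - p y) \<bullet> (t *\<^sub>R d)"
      using mono[of "y + t *\<^sub>R d" y] by simp
    then have "0 \<le> t * k' t"
      unfolding power2_norm_eq_inner k'_def
      by (simp add: inner_diff_left algebra_simps)
    with that False show ?thesis
      by (simp add: zero_le_mult_iff)
  qed (simp add: k'_def)
  have "k 0 \<le> k 1"
    using deriv nonneg by (intro DERIV_nonneg_imp_nondecreasing[of 0 1 k]) auto
  then show ?thesis
    by (simp add: k_def d_def power2_norm_eq_inner)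
qed

text \<open>
  In terms of \<open>q w = p w - m w\<close>, the gradient of \<open>h - m phi0\<close>, the point z below is the
  gradient step \<open>y - (q y - q x) / (L - m)\<close> for the function whose gradient is \<open>q - q x\<close>. The
  lower bound puts the minimum of that function at x, and the upper bound guarantees a decrease of
  at least \<open>(norm (q x - q y))\<^sup>2 / (2 (L - m))\<close> in the step from y. So its value at y exceeds its
  minimum by at least this amount.
\<close>

lemma bregman_ge_of_quadratic_bounds:
  fixes h :: "'a::real_inner \<Rightarrow> real" and p :: "'a \<Rightarrow> 'a"
  assumes "m < L"
    and lower: "\<And>x y. m * ((norm (x - y))\<^sup>2 / 2) \<le> h x - h y - p y \<bullet> (x - y)"
    and upper: "\<And>x y. h x - h y - p y \<bullet> (x - y) \<le> L * ((norm (x - y))\<^sup>2 / 2)"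
  shows "m / 2 * (norm (x - y))\<^sup>2 + 1 / (2 * (L - m)) * (norm (p x - p y - m *\<^sub>R (x - y)))\<^sup>2
           \<le> h y - h x - p x \<bullet> (y - x)"
proof -
  define M where "M = L - m"
  define d where "d = x - y"
  define u where "u = p x - p y - m *\<^sub>R d"
  define s where "s = (1 / M) *\<^sub>R u"
  define z where "z = y + s"
  have "M > 0" and L: "L = M + m"
    using assms(1) by (simp_all add: M_def)
  have u: "u = M *\<^sub>R s"
    using \<open>M > 0\<close> by (simp add: s_def)
  have G: "p x - p y = M *\<^sub>R s + m *\<^sub>R d"
    using u by (simp add: u_def algebra_simps)
  have zx: "z - x = s - d" and zy: "z - y = s"
    by (simp_all add: z_def d_def)
  have "m / 2 * ((s - d) \<bullet> (s - d)) - L / 2 * (s \<bullet> s) + (p x - p y) \<bullet> s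
          \<le> (h z - h x - p x \<bullet> (s - d)) - (h z - h y - p y \<bullet> s) + (p x - p y) \<bullet> s"
    using lower[of z x] upper[of z y] unfolding zx zy power2_norm_eq_inner by simp
  also have "\<dots> = h y - h x - p x \<bullet> (y - x)"
    by (simp add: d_def inner_diff_left inner_diff_right)
  also have "m / 2 * ((s - d) \<bullet> (s - d)) - L / 2 * (s \<bullet> s) + (p x - p y) \<bullet> s
               = m / 2 * (d \<bullet> d) + M / 2 * (s \<bullet> s)"
    unfolding G L
    by (simp add: inner_diff_left inner_diff_right inner_add_left inner_add_right inner_commute field_simps)
  also have "M / 2 * (s \<bullet> s) = 1 / (2 * M) * (u \<bullet> u)"
    using \<open>M > 0\<close> by (simp add: u field_simps)
  finally show ?thesis
    by (simp add: power2_norm_eq_inner u_def d_def M_def)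
qed

lemma interpolation_remainder_eq:
  fixes G d :: "'a::real_inner"
  assumes "L \<noteq> 0" and "\<mu> \<noteq> L"
  shows "1 / (2 * L) * (norm G)\<^sup>2 + \<mu> * L / (2 * (L - \<mu>)) * (norm (d - (1 / L) *\<^sub>R G))\<^sup>2
           = \<mu> / 2 * (norm d)\<^sup>2 + 1 / (2 * (L - \<mu>)) * (norm (G - \<mu> *\<^sub>R d))\<^sup>2"
proof -
  define e where "e = d - (1 / L) *\<^sub>R G"
  define M where "M = L - \<mu>"
  have "M \<noteq> 0" and \<mu>: "\<mu> = L - M"
    using assms by (simp_all add: M_def)
  have G: "G = L *\<^sub>R (d - e)"
    using assms by (simp add: e_def)
  \<comment> \<open>In terms of d and e, both sides are polynomials divided by M.\<close>
  have "G - \<mu> *\<^sub>R d = M *\<^sub>R d - L *\<^sub>R e"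
    unfolding G \<mu> by (simp add: algebra_simps)
  then show ?thesis
    unfolding e_def[symmetric] M_def[symmetric] power2_norm_eq_inner
    using assms(1) \<open>M \<noteq> 0\<close>
    by (simp add: G \<mu> inner_diff_left inner_diff_right inner_commute field_simps)
qed

lemma cocoercive_iff:
  fixes G d :: "'a::real_inner"
  assumes "0 < L + \<mu>"
  shows "L * \<mu> / (L + \<mu>) * (norm d)\<^sup>2 + 1 / (L + \<mu>) * (norm G)\<^sup>2 \<le> G \<bullet> d
           \<longleftrightarrow> 0 \<le> (G - \<mu> *\<^sub>R d) \<bullet> (L *\<^sub>R d - G)"
proof -
  have "L * \<mu> / (L + \<mu>) * (norm d)\<^sup>2 + 1 / (L + \<mu>) * (norm G)\<^sup>2
          = (L * \<mu> * (d \<bullet> d) + G \<bullet> G) / (L + \<mu>)"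
    by (simp add: power2_norm_eq_inner add_divide_distrib)
  moreover have "(G - \<mu> *\<^sub>R d) \<bullet> (L *\<^sub>R d - G) = G \<bullet> d * (L + \<mu>) - (L * \<mu> * (d \<bullet> d) + G \<bullet> G)"
    by (simp add: inner_diff_left inner_diff_right inner_commute algebra_simps)
  ultimately show ?thesis
    using assms by (simp add: pos_divide_le_eq)
qed

text \<open>
  Writing \<open>v = G - \<mu> d\<close>, the hypothesis reads \<open>v \<bullet> v \<le> (L - \<mu>) (v \<bullet> d)\<close>; hence \<open>v \<bullet> d\<close> is
  nonnegative, which is the lower bound. With \<open>w = L d - G\<close> the hypothesis reads
  \<open>w \<bullet> w \<le> (L - \<mu>) (w \<bullet> d)\<close>, and the upper bound follows in the same way.
\<close>

lemma inner_bounds_of_diameter_ball: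
  fixes G d :: "'a::real_inner"
  assumes "\<mu> < L" and "0 \<le> (G - \<mu> *\<^sub>R d) \<bullet> (L *\<^sub>R d - G)"
  shows "\<mu> * (norm d)\<^sup>2 \<le> G \<bullet> d" and "G \<bullet> d \<le> L * (norm d)\<^sup>2"
proof -
  let ?v = "G - \<mu> *\<^sub>R d" and ?w = "L *\<^sub>R d - G"
  have "(L - \<mu>) * (?v \<bullet> d) = ?v \<bullet> ?w + ?v \<bullet> ?v"
    by (simp add: inner_diff_left inner_diff_right inner_commute algebra_simps)
  with assms have "0 \<le> ?v \<bullet> d"
    by (smt (verit) inner_ge_zero mult_pos_neg)
  then show "\<mu> * (norm d)\<^sup>2 \<le> G \<bullet> d"
    by (simp add: power2_norm_eq_inner inner_diff_left)
  have "(L - \<mu>) * (?w \<bullet> d) = ?v \<bullet> ?w + ?w \<bullet> ?w"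
    by (simp add: inner_diff_left inner_diff_right inner_commute algebra_simps)
  with assms have "0 \<le> ?w \<bullet> d"
    by (smt (verit) inner_ge_zero mult_pos_neg)
  then show "G \<bullet> d \<le> L * (norm d)\<^sup>2"
    by (simp add: power2_norm_eq_inner inner_diff_left)
qed

theorem proposition3p5:
  fixes f :: "real ^ 'd \<Rightarrow> real" and \<mu> L :: real
  assumes "0 \<le> \<mu>" and "\<mu> < L"
    and "\<And>x. f differentiable (at x)"
  shows "((L_smooth L f \<and> strongly_convex \<mu> f) \<longleftrightarrow>
           (\<forall>x y. inner (grad f x - grad f y) (x - y)
                   \<ge> L * \<mu> / (L + \<mu>) * (norm (x - y))\<^sup>2
                     + 1 / (L + \<mu>) * (norm (grad f x - grad f y))\<^sup>2))
       \<and> ((L_smooth L f \<and> strongly_convex \<mu> f) \<longleftrightarrow>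
           (\<forall>x y. f y
                   \<ge> f x + inner (grad f x) (y - x)
                     + 1 / (2 * L) * (norm (grad f x - grad f y))\<^sup>2
                     + \<mu> * L / (2 * (L - \<mu>))
                       * (norm (x - y - (1 / L) *\<^sub>R (grad f x - grad f y)))\<^sup>2))"
    (is "(?S \<longleftrightarrow> ?A) \<and> (?S \<longleftrightarrow> ?B)")
proof -
  have "0 < L" and "0 < L + \<mu>"
    using assms(1,2) by linarith+
  have gderiv: "GDERIV f x :> grad f x" for x
    using assms(3) by (rule GDERIV_grad)
  have B_iff: "?B \<longleftrightarrow>
      (\<forall>x y. \<mu> / 2 * (norm (x - y))\<^sup>2
             + 1 / (2 * (L - \<mu>)) * (norm (grad f x - grad f y - \<mu> *\<^sub>R (x - y)))\<^sup>2
             \<le> f y - f x - grad f x \<bullet> (y - x))"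
  proof -
    have "\<mu> \<noteq> L" and "L \<noteq> 0"
      using assms(2) \<open>0 < L\<close> by simp_all
    note eq = interpolation_remainder_eq[OF this(2,1)]
    show ?thesis
      unfolding eq[symmetric] by (intro iff_allI) (rule iffI; linarith)
  qed
  have "?S \<Longrightarrow> ?B"
    unfolding B_iff
  proof (intro allI)
    fix x y :: "real ^ 'd"
    assume S: ?S
    show "\<mu> / 2 * (norm (x - y))\<^sup>2
            + 1 / (2 * (L - \<mu>)) * (norm (grad f x - grad f y - \<mu> *\<^sub>R (x - y)))\<^sup>2
            \<le> f y - f x - grad f x \<bullet> (y - x)"
    proof (rule bregman_ge_of_quadratic_bounds[OF assms(2)])
      show "\<mu> * ((norm (x - y))\<^sup>2 / 2) \<le> f x - f y - grad f y \<bullet> (x - y)" for x y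
        using S by (simp only: strongly_convex_iff)
      show "f x - f y - grad f y \<bullet> (x - y) \<le> L * ((norm (x - y))\<^sup>2 / 2)" for x y
        using S by (simp only: L_smooth_iff)
    qed
  qed
  moreover have "?B \<Longrightarrow> ?A"
    unfolding B_iff cocoercive_iff[OF \<open>0 < L + \<mu>\<close>]
  proof (intro allI)
    fix x y :: "real ^ 'd"
    assume B: "\<forall>x y. \<mu> / 2 * (norm (x - y))\<^sup>2
             + 1 / (2 * (L - \<mu>)) * (norm (grad f x - grad f y - \<mu> *\<^sub>R (x - y)))\<^sup>2
             \<le> f y - f x - grad f x \<bullet> (y - x)"
    define d where "d = x - y"
    define G where "G = grad f x - grad f y"
    define v where "v = G - \<mu> *\<^sub>R d"
    have "norm (y - x) = norm d"
      by (simp add: d_def norm_minus_commute)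
    moreover have "norm (grad f y - grad f x - \<mu> *\<^sub>R (y - x)) = norm v"
    proof -
      have "grad f y - grad f x - \<mu> *\<^sub>R (y - x) = - v"
        by (simp add: v_def G_def d_def algebra_simps)
      then show ?thesis
        by simp
    qed
    moreover have "- (grad f x \<bullet> (y - x)) - grad f y \<bullet> (x - y) = G \<bullet> d"
      by (simp add: G_def d_def inner_diff_left inner_diff_right)
    moreover have "norm (x - y) = norm d" "norm (grad f x - grad f y - \<mu> *\<^sub>R (x - y)) = norm v"
      by (simp_all add: v_def G_def d_def)
    moreover note B[rule_format, of x y] B[rule_format, of y x]
    ultimately have "2 * (\<mu> / 2 * (norm d)\<^sup>2 + 1 / (2 * (L - \<mu>)) * (norm v)\<^sup>2) \<le> G \<bullet> d"
      by simp
    also have "2 * (\<mu> / 2 * (norm d)\<^sup>2 + 1 / (2 * (L - \<mu>)) * (norm v)\<^sup>2)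
                 = \<mu> * (d \<bullet> d) + (v \<bullet> v) / (L - \<mu>)"
      using assms(2) by (simp add: power2_norm_eq_inner divide_simps) (simp add: algebra_simps)
    also have "G \<bullet> d = v \<bullet> d + \<mu> * (d \<bullet> d)"
      by (simp add: v_def inner_diff_left)
    finally have "(v \<bullet> v) / (L - \<mu>) \<le> v \<bullet> d"
      by simp
    then have "v \<bullet> v \<le> (L - \<mu>) * (v \<bullet> d)"
      using assms(2) by (simp add: pos_divide_le_eq mult.commute)
    moreover have "L *\<^sub>R d - G = (L - \<mu>) *\<^sub>R d - v"
      by (simp add: v_def algebra_simps)
    ultimately have "0 \<le> v \<bullet> (L *\<^sub>R d - G)"
      by (simp add: inner_diff_right)
    then show "0 \<le> (grad f x - grad f y - \<mu> *\<^sub>R (x - y)) \<bullet> (L *\<^sub>R (x - y) - (grad f x - grad f y))"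
      by (simp only: v_def G_def d_def)
  qed
  moreover have "?A \<Longrightarrow> ?S"
  proof -
    assume ?A
    then have ball: "0 \<le> (grad f x - grad f y - \<mu> *\<^sub>R (x - y)) \<bullet> (L *\<^sub>R (x - y) - (grad f x - grad f y))"
      for x y
      using cocoercive_iff[OF \<open>0 < L + \<mu>\<close>] by blast
    note bounds = inner_bounds_of_diameter_ball[OF assms(2) ball]
    have "strongly_convex \<mu> f"
      unfolding strongly_convex_iff
      using bregman_ge_of_monotone_gradient[OF gderiv bounds(1)] by blast
    moreover have "L_smooth L f"
    proof -
      have "GDERIV (\<lambda>x. - f x) x :> - grad f x" for x
        using gderiv by (rule GDERIV_minus)
      moreover have "- L * (norm (x - y))\<^sup>2 \<le> (- grad f x - - grad f y) \<bullet> (x - y)" for x y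
        using bounds(2)[of x y] by (simp add: inner_diff_left)
      ultimately have neg:
        "- L * ((norm (x - y))\<^sup>2 / 2) \<le> - f x - - f y - (- grad f y) \<bullet> (x - y)" for x y
        by (rule bregman_ge_of_monotone_gradient)
      have "f x - f y - grad f y \<bullet> (x - y) \<le> L * ((norm (x - y))\<^sup>2 / 2)" for x y
        using neg[of x y] unfolding inner_minus_left mult_minus_left by linarith
      then show ?thesis
        unfolding L_smooth_iff by blast
    qed
    ultimately show ?S
      by blast
  qed
  ultimately show ?thesis
    by blast
qed

end
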